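(* Let $L$ be a finite-dimensional $S$-Lie algebra over a field $F$, and let $x\in L$. Then: (1) $C_L(x)\subseteq\mathrm{sol}_L(x)$ and $\dim C_L(x)\le\dim\mathrm{sol}_L(x)$. In particular, if $F$ is finite, then $|C_L(x)|\le|\mathrm{sol}_L(x)|$. (2) There exists $\mathcal{R}_x\subseteq\mathrm{sol}_L(x)$ such that \[\mathrm{sol}_L(x)=\bigsqcup_{a\in\mathcal{R}_x}(a+C_L(x)),\] and consequently, if $F$ is finite, $|C_L(x)|$ divides $|\mathrm{sol}_L(x)|$.
   Context: For elements $x,y$ of a Lie algebra $L$, $\langle x,y\rangle$ denotes the Lie subalgebra generated by $x$ and $y$. For $x\in L$, the solvabilizer of $x$ in $L$ is $\mathrm{sol}_L(x)=\{y\in L\mid \langle x,y\rangle \text{ is solvable}\}$, and the centralizer of $x$ is $C_L(x)=\{y\in L\mid [x,y]=0\}$. A finite-dimensional Lie algebra $L$ is called an $S$-Lie algebra if $\mathrm{sol}_L(x)$ is a Lie subalgebra of $L$ for every $x\in L$. The symbol $\bigsqcup$ denotes disjoint union. *)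

theory Defs
  imports Complex_Main "HOL-Library.Disjoint_Sets"
begin

locale lie_algebra = vector_space scale
  for scale :: "'f::field \<Rightarrow> 'l::ab_group_add \<Rightarrow> 'l"  (infixr \<open>*s\<close> 75) +
  fixes bracket :: "'l \<Rightarrow> 'l \<Rightarrow> 'l"
  assumes bracket_add_left: "bracket (x + y) z = bracket x z + bracket y z"
    and bracket_add_right: "bracket x (y + z) = bracket x y + bracket x z"
    and bracket_scale_left: "bracket (c *s x) y = c *s bracket x y"
    and bracket_scale_right: "bracket x (c *s y) = c *s bracket x y"
    and bracket_self: "bracket x x = 0"
    and jacobi: "bracket x (bracket y z) + bracket y (bracket z x) + bracket z (bracket x y) = 0"
begin

definition lie_subalgebra :: "'l set \<Rightarrow> bool" where
  "lie_subalgebra A \<longleftrightarrow> subspace A \<and> (\<forall>x\<in>A. \<forall>y\<in>A. bracket x y \<in> A)"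

definition lie_generated :: "'l set \<Rightarrow> 'l set" where
  "lie_generated X = lie_subalgebra hull X"

definition bracket_span :: "'l set \<Rightarrow> 'l set \<Rightarrow> 'l set" where
  "bracket_span A B = span {bracket a b | a b. a \<in> A \<and> b \<in> B}"

primrec derived_series :: "'l set \<Rightarrow> nat \<Rightarrow> 'l set" where
  "derived_series A 0 = A"
| "derived_series A (Suc n) = bracket_span (derived_series A n) (derived_series A n)"

definition lie_solvable :: "'l set \<Rightarrow> bool" where
  "lie_solvable A \<longleftrightarrow> (\<exists>n. derived_series A n = {0})"

definition solvabilizer :: "'l \<Rightarrow> 'l set" where
  "solvabilizer x = {y. lie_solvable (lie_generated {x, y})}"

definition centralizer :: "'l \<Rightarrow> 'l set" where
  "centralizer x = {y. bracket x y = 0}"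

end

locale S_lie_algebra = lie_algebra +
  assumes finite_dimensional: "\<exists>B. finite B \<and> span B = UNIV"
    and solvabilizer_subalgebra: "lie_subalgebra (solvabilizer x)"

end

theory Submission imports Defs begin

text \<open>If \<open>y\<close> commutes with \<open>x\<close>, then all brackets among
  \<open>x\<close> and \<open>y\<close> vanish, so the subalgebra they generate is abelian and hence
  solvable (\<open>lie_solvable_generated_commuting\<close>). This gives the inclusion of the
  centralizer in the solvabilizer, and finite dimension turns it into the inequality of dimensions.
  The S-property makes the solvabilizer a subspace, so it is a union of additive cosets of the
  centralizer; one representative per coset makes the union disjoint
  (\<open>coset_decomposition\<close>). Over a finite field the whole algebra is finite, and since
  all cosets have the same size, counting them gives divisibility.\<close>

lemma (in vector_space) finite_span:
  assumes "finite (UNIV :: 'a set)" and "finite B"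
  shows "finite (span B)"
  using assms(2)
proof (induction B rule: finite_induct)
  case empty
  then show ?case by simp
next
  case (insert b B)
  have "span (insert b B) \<subseteq> (\<lambda>(k, y). y + k *s b) ` (UNIV \<times> span B)"
    unfolding span_insert by (force intro!: image_eqI)
  then show ?case
    using insert.IH assms(1) by (meson finite_SigmaI finite_imageI finite_subset)
qed

text \<open>Finite dimension matters because \<open>dim\<close> is 0 for a space without a finite
  basis. A basis extracted from the finite spanning set gives access to the finite-dimensional
  theory.\<close>

lemma (in vector_space) dim_mono_finite_span:
  assumes "finite B" and "span B = UNIV" and "V \<subseteq> W"
  shows "dim V \<le> dim W"
proof -
  obtain B' where "B' \<subseteq> B" and B': "independent B'" "B \<subseteq> span B'"
    using maximal_independent_subset[of B] by blast
  have "span B' = UNIV"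
    using B'(2) assms(2) span_minimal subspace_span by blast
  then interpret fd: finite_dimensional_vector_space scale B'
    using B'(1) \<open>B' \<subseteq> B\<close> assms(1) by unfold_locales (auto intro: finite_subset)
  show ?thesis
    using assms(3) by (rule fd.dim_subset)
qed

lemma (in vector_space) coset_eq_iff:
  assumes "subspace C"
  shows "(+) a ` C = (+) b ` C \<longleftrightarrow> b - a \<in> C"
proof
  assume "(+) a ` C = (+) b ` C"
  then have "b + 0 \<in> (+) a ` C"
    using subspace_0[OF assms] by blast
  then show "b - a \<in> C" by auto
next
  assume *: "b - a \<in> C"
  have "b + c \<in> (+) a ` C" if "c \<in> C" for c
    using subspace_add[OF assms * that] by (intro image_eqI[of _ _ "(b - a) + c"]) auto
  moreover have "a + c \<in> (+) b ` C" if "c \<in> C" for c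
    using subspace_diff[OF assms that *] by (intro image_eqI[of _ _ "c - (b - a)"]) auto
  ultimately show "(+) a ` C = (+) b ` C" by blast
qed

text \<open>The set \<open>R\<close> is a transversal: the image of \<open>S\<close> under a choice
  of one element from each coset of \<open>C\<close>.\<close>

lemma (in vector_space) coset_decomposition:
  assumes C: "subspace C" and S: "subspace S" and "C \<subseteq> S"
  obtains R where "R \<subseteq> S" and "S = (\<Union>a\<in>R. (+) a ` C)"
    and "disjoint_family_on (\<lambda>a. (+) a ` C) R"
proof -
  \<comment> \<open>The choice is made from the coset as a set, so equal cosets get the same
    representative; this is what \<open>r_cong\<close> uses.\<close>
  define r where "r y = (SOME z. z \<in> (+) y ` C)" for y
  have r: "r y - y \<in> C" for y
  proof -
    have "r y \<in> (+) y ` C"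
      unfolding r_def using imageI[OF subspace_0[OF C]] by (rule someI)
    then show ?thesis by auto
  qed
  have r_cong: "r y = r z" if "z - y \<in> C" for y z
    using coset_eq_iff[OF C, of y z] that by (simp add: r_def)
  have r_idem: "r (r y) = r y" for y
    by (rule r_cong[OF r, symmetric])
  show thesis
  proof
    have "r y \<in> S" if "y \<in> S" for y
      using subspace_add[OF S _ that, of "r y - y"] r[of y] \<open>C \<subseteq> S\<close> by auto
    then show "r ` S \<subseteq> S" by blast
    then have "a + c \<in> S" if "a \<in> r ` S" "c \<in> C" for a c
      using that \<open>C \<subseteq> S\<close> subspace_add[OF S] by blast
    moreover have "y \<in> (+) (r y) ` C" for y
      using subspace_neg[OF C r, of y] by (intro image_eqI[of _ _ "y - r y"]) auto
    ultimately show "S = (\<Union>a\<in>r ` S. (+) a ` C)" by blast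
    show "disjoint_family_on (\<lambda>a. (+) a ` C) (r ` S)"
      unfolding disjoint_family_on_def
    proof (intro ballI impI)
      fix a b
      assume ab: "a \<in> r ` S" "b \<in> r ` S" "a \<noteq> b"
      \<comment> \<open>If two cosets meet, their representatives differ by an element of
        \<open>C\<close>, so \<open>r\<close> agrees on them; being values of the idempotent
        \<open>r\<close>, they coincide.\<close>
      have "a = b" if "a + c = b + d" "c \<in> C" "d \<in> C" for c d
      proof -
        have "b - a = c - d" using that(1) by (simp add: algebra_simps)
        then have "b - a \<in> C" using subspace_diff[OF C that(2,3)] by simp
        then have "r a = r b" by (rule r_cong)
        then show "a = b" using r_idem ab(1,2) by (metis imageE)
      qed
      then show "(+) a ` C \<inter> (+) b ` C = {}" using ab(3) by blast
    qed
  qed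
qed

lemma card_dvd_disjoint_translates:
  fixes C :: "'a::ab_group_add set"
  assumes "S = (\<Union>a\<in>R. (+) a ` C)" and "disjoint_family_on (\<lambda>a. (+) a ` C) R"
    and "finite R" and "finite C"
  shows "card C dvd card S"
proof -
  have "card S = (\<Sum>a\<in>R. card ((+) a ` C))"
    unfolding assms(1) using assms(2-4)
    by (intro card_UN_disjoint) (auto simp: disjoint_family_on_def)
  also have "\<dots> = card R * card C"
    by (simp add: card_image)
  finally show ?thesis by simp
qed

context lie_algebra
begin

lemma bracket_zero_right: "bracket a 0 = 0"
  using bracket_scale_right[of a 0 0] by simp

lemma subspace_centralizer: "subspace (centralizer a)"
  by (rule subspaceI)
    (simp_all add: centralizer_def bracket_zero_right bracket_add_right bracket_scale_right)

lemma bracket_anticommute: "bracket a b = - bracket b a"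
proof -
  have "bracket (a + b) (a + b) = bracket a b + bracket b a"
    unfolding bracket_add_left bracket_add_right by (simp add: bracket_self)
  then show ?thesis
    by (simp add: bracket_self eq_neg_iff_add_eq_0)
qed

lemma centralizer_sym: "b \<in> centralizer a \<longleftrightarrow> a \<in> centralizer b"
  using bracket_anticommute[of a b] by (simp add: centralizer_def)

text \<open>Centralizers are subspaces, so commuting extends from \<open>X\<close> to its span one
  argument at a time; \<open>centralizer_sym\<close> switches between the arguments.\<close>

lemma bracket_span_eq_zero:
  assumes "\<And>a b. a \<in> X \<Longrightarrow> b \<in> X \<Longrightarrow> bracket a b = 0"
    and "a \<in> span X" and "b \<in> span X"
  shows "bracket a b = 0"
proof -
  have "span X \<subseteq> centralizer c" if "c \<in> X" for c
    using assms(1) that by (intro span_minimal subspace_centralizer) (auto simp: centralizer_def)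
  then have "X \<subseteq> centralizer a"
    using assms(2) centralizer_sym by blast
  then have "span X \<subseteq> centralizer a"
    by (rule span_minimal[OF _ subspace_centralizer])
  then show ?thesis
    using assms(3) by (auto simp: centralizer_def)
qed

text \<open>The linear span of \<open>X\<close> is already closed under brackets, so it contains the
  generated subalgebra, whose derived series therefore vanishes after one step.\<close>

lemma lie_solvable_generated_commuting:
  assumes "\<And>a b. a \<in> X \<Longrightarrow> b \<in> X \<Longrightarrow> bracket a b = 0"
  shows "lie_solvable (lie_generated X)"
proof -
  have "lie_subalgebra (span X)"
    using bracket_span_eq_zero[OF assms] by (simp add: lie_subalgebra_def span_zero)
  then have "lie_generated X \<subseteq> span X"
    unfolding lie_generated_def by (intro hull_minimal span_superset)
  then have "{bracket a b | a b. a \<in> lie_generated X \<and> b \<in> lie_generated X} \<subseteq> {0}"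
    using bracket_span_eq_zero[OF assms] by blast
  then have "derived_series (lie_generated X) 1 \<subseteq> {0}"
    by (simp add: bracket_span_def span_minimal)
  moreover have "0 \<in> derived_series (lie_generated X) 1"
    by (simp add: bracket_span_def span_zero)
  ultimately show ?thesis
    unfolding lie_solvable_def by blast
qed

lemma centralizer_subset_solvabilizer: "centralizer x \<subseteq> solvabilizer x"
proof
  fix y
  assume "y \<in> centralizer x"
  then have "bracket x y = 0" "bracket y x = 0"
    using centralizer_sym[of y x] by (auto simp: centralizer_def)
  then have "lie_solvable (lie_generated {x, y})"
    by (intro lie_solvable_generated_commuting) (auto simp: bracket_self)
  then show "y \<in> solvabilizer x"
    by (simp add: solvabilizer_def)
qed

end

theorem proposition3p21:
  fixes scale :: "'f::field \<Rightarrow> 'l::ab_group_add \<Rightarrow> 'l"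
    and bracket :: "'l \<Rightarrow> 'l \<Rightarrow> 'l"
    and x :: 'l
  defines "C \<equiv> lie_algebra.centralizer bracket x"
    and "S \<equiv> lie_algebra.solvabilizer scale bracket x"
  assumes "S_lie_algebra scale bracket"
  shows "(C \<subseteq> S
          \<and> vector_space.dim scale C \<le> vector_space.dim scale S
          \<and> (finite (UNIV :: 'f set) \<longrightarrow> card C \<le> card S))
       \<and> ((\<exists>R. R \<subseteq> S
               \<and> S = (\<Union>a\<in>R. (+) a ` C)
               \<and> disjoint_family_on (\<lambda>a. (+) a ` C) R)
          \<and> (finite (UNIV :: 'f set) \<longrightarrow> card C dvd card S))"
proof -
  interpret S_lie_algebra scale bracket by fact
  obtain B where B: "finite B" "span B = UNIV"
    using finite_dimensional by blast
  have CS: "C \<subseteq> S"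
    unfolding C_def S_def by (rule centralizer_subset_solvabilizer)
  have "subspace C" "subspace S"
    using solvabilizer_subalgebra[of x]
    by (simp_all add: C_def S_def subspace_centralizer lie_subalgebra_def)
  then obtain R where R: "R \<subseteq> S" "S = (\<Union>a\<in>R. (+) a ` C)"
      "disjoint_family_on (\<lambda>a. (+) a ` C) R"
    using CS by (rule coset_decomposition)
  \<comment> \<open>Finiteness has to be secured before counting, since \<open>card\<close> is 0 on
    infinite sets. Here the whole algebra is finite, as the span of the finite set \<open>B\<close>
    over a finite field.\<close>
  have fin: "finite A" if "finite (UNIV :: 'f set)" for A :: "'l set"
    using finite_span[OF that B(1)] B(2) by (simp add: finite_subset[of A UNIV])
  have "dim C \<le> dim S"
    using B CS by (rule dim_mono_finite_span)
  moreover have "card C \<le> card S" if "finite (UNIV :: 'f set)"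
    using fin[OF that] CS by (rule card_mono)
  moreover have "card C dvd card S" if "finite (UNIV :: 'f set)"
    using R(2,3) fin[OF that] fin[OF that] by (rule card_dvd_disjoint_translates)
  ultimately show ?thesis
    using CS R by blast
qed

end
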